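(* Let $n\ge1$ and let $v=(a,b)\in\mathbb{Z}^2$ with $\gcd(a,b)=1$. Let $\ell_1,\dots,\ell_r$ be the lines of direction $v$ into which the cells of $\{0,1,\dots,n-1\}^2$ are partitioned, and let $L_i=|\ell_i|$ be their lengths. Let $m$ be an integer with $2\le m\le\sum_{i=1}^r\min(L_i,2)$ and let $S$ be uniformly distributed on the set of $m$-element subsets of $\{0,1,\dots,n-1\}^2$ that contain at most two cells of every line $\ell_i$. Then the number of such subsets is $$Z_m=[t^m]\prod_{i=1}^{r}\Bigl(1+L_it+\binom{L_i}{2}t^2\Bigr)$$ and $$\mathbb{E}\bigl[\#\{i:\ |S\cap\ell_i|=2\}\bigr]=\frac{1}{Z_m}\sum_{i=1}^{r}\binom{L_i}{2}\,[t^{m-2}]\prod_{j\ne i}\Bigl(1+L_jt+\binom{L_j}{2}t^2\Bigr).$$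
   Context: The lines of direction $v$ in $\{0,\dots,n-1\}^2$ are the equivalence classes of cells under the relation $p\sim q$ iff $q-p=kv$ for some $k\in\mathbb{Z}$; a cell with no neighbour in direction $\pm v$ in the grid forms a line of length $1$. The length of a line is the number of its cells. $[t^k]f(t)$ denotes the coefficient of $t^k$ in the polynomial $f(t)$. *)

theory Defs
  imports "HOL-Probability.Probability" "HOL-Computational_Algebra.Polynomial"
begin

definition grid :: "nat \<Rightarrow> (int \<times> int) set" where
  "grid n = {0..<int n} \<times> {0..<int n}"

definition same_line :: "nat \<Rightarrow> int \<times> int \<Rightarrow> ((int \<times> int) \<times> (int \<times> int)) set" where
  "same_line n v =
     {(p, q). p \<in> grid n \<and> q \<in> grid n \<and> (\<exists>k::int. q - p = (k * fst v, k * snd v))}"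

definition lines :: "nat \<Rightarrow> int \<times> int \<Rightarrow> (int \<times> int) set set" where
  "lines n v = grid n // same_line n v"

definition admissible :: "nat \<Rightarrow> int \<times> int \<Rightarrow> nat \<Rightarrow> (int \<times> int) set set" where
  "admissible n v m =
     {S. S \<subseteq> grid n \<and> card S = m \<and> (\<forall>l \<in> lines n v. card (S \<inter> l) \<le> 2)}"

text \<open>The polynomial \<open>1 + L t + (L choose 2) t\<^sup>2\<close>, coefficients listed from degree 0 upwards.\<close>

definition line_poly :: "nat \<Rightarrow> nat poly" where
  "line_poly L = [:1, L, L choose 2:]"

end

theory Submission
  imports Defs
begin

text \<open>The lines partition the grid, so a subset of the grid is the same as an independent choice of
  a subset of every line. Prescribing a set \<open>K i\<close> of allowed cardinalities on the \<open>i\<close>-th line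
  therefore makes the generating function of the number of such subsets a product over the lines.
  With \<open>K i = {0, 1, 2}\<close> for all \<open>i\<close> this counts the admissible sets; changing a single
  \<open>K i\<close> to \<open>{2}\<close> counts those that meet the \<open>i\<close>-th line twice, and the expectation is
  the sum of these counts over \<open>i\<close>.\<close>

definition restricted_subsets ::
    "'i set \<Rightarrow> ('i \<Rightarrow> 'a set) \<Rightarrow> ('i \<Rightarrow> nat set) \<Rightarrow> nat \<Rightarrow> 'a set set" where
  "restricted_subsets I A K m =
     {S. S \<subseteq> (\<Union>i\<in>I. A i) \<and> card S = m \<and> (\<forall>i\<in>I. card (S \<inter> A i) \<in> K i)}"

lemma finite_restricted_subsets:
  assumes "finite I" "\<And>i. i \<in> I \<Longrightarrow> finite (A i)"
  shows "finite (restricted_subsets I A K m)"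
proof (rule finite_subset)
  show "restricted_subsets I A K m \<subseteq> Pow (\<Union>i\<in>I. A i)"
    by (auto simp: restricted_subsets_def)
qed (use assms in auto)

text \<open>Since \<open>A i\<close> is disjoint from the other blocks, cutting \<open>S\<close>
  into \<open>S \<inter> A i\<close> and \<open>S - A i\<close> loses nothing and leaves the traces
  on the other blocks unchanged. The bound \<open>card T \<le> m\<close> guards against truncated
  subtraction: for larger \<open>T\<close>, \<open>m - card T\<close> would be 0 and
  \<open>V = {}\<close> could give a spurious pair.\<close>

lemma bij_betw_restricted_subsets_insert:
  assumes "finite I" and "i \<notin> I"
    and fin: "\<And>j. j \<in> insert i I \<Longrightarrow> finite (A j)"
    and disj: "disjoint_family_on A (insert i I)"
  shows "bij_betw (\<lambda>(T, U). T \<union> U)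
           (SIGMA T : {T. T \<subseteq> A i \<and> card T \<in> K i \<and> card T \<le> m}. restricted_subsets I A K (m - card T))
           (restricted_subsets (insert i I) A K m)"
    (is "bij_betw _ ?D ?R")
proof (rule bij_betw_byWitness[where f' = "\<lambda>S. (S \<inter> A i, S - A i)"])
  let ?U = "\<Union>j\<in>I. A j"
  have finU: "finite ?U" and finA: "finite (A i)"
    using assms(1) fin by auto
  have AU: "A i \<inter> ?U = {}"
    using disj assms(2) by (auto simp: disjoint_family_on_def)
  have Aj: "A i \<inter> A j = {}" if "j \<in> I" for j
    using AU that by auto
  show "\<forall>x\<in>?D. (\<lambda>S. (S \<inter> A i, S - A i)) ((\<lambda>(T, U). T \<union> U) x) = x"
    using AU by (auto simp: restricted_subsets_def)
  show "\<forall>S\<in>?R. (\<lambda>(T, U). T \<union> U) (S \<inter> A i, S - A i) = S"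
    by auto
  show "(\<lambda>(T, U). T \<union> U) ` ?D \<subseteq> ?R"
  proof clarify
    fix T V
    assume T: "T \<subseteq> A i" "card T \<in> K i" "card T \<le> m"
      and V: "V \<in> restricted_subsets I A K (m - card T)"
    have VU: "V \<subseteq> ?U" "card V = m - card T"
      using V by (auto simp: restricted_subsets_def)
    have "finite T" "finite V" "T \<inter> V = {}"
      using T VU finA finU AU by (auto intro: finite_subset)
    then have "card (T \<union> V) = m"
      using T VU by (simp add: card_Un_disjoint)
    moreover have "(T \<union> V) \<inter> A i = T"
      using T VU AU by auto
    moreover have "(T \<union> V) \<inter> A j = V \<inter> A j" if "j \<in> I" for j
      using T Aj[OF that] by auto
    ultimately show "T \<union> V \<in> ?R"
      using T V by (auto simp: restricted_subsets_def)
  qed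
  show "(\<lambda>S. (S \<inter> A i, S - A i)) ` ?R \<subseteq> ?D"
  proof (rule image_subsetI)
    fix S assume S: "S \<in> ?R"
    have SU: "S \<subseteq> A i \<union> ?U" "card S = m"
      using S by (auto simp: restricted_subsets_def)
    have "finite S"
      using SU finA finU by (auto intro: finite_subset)
    then have "card (S \<inter> A i) \<le> m" and "card (S - A i) = m - card (S \<inter> A i)"
      using SU by (auto intro: card_mono simp: card_Diff_subset_Int)
    moreover have "(S - A i) \<inter> A j = S \<inter> A j" if "j \<in> I" for j
      using Aj[OF that] by auto
    ultimately show "(S \<inter> A i, S - A i) \<in> ?D"
      using S by (auto simp: restricted_subsets_def)
  qed
qed

text \<open>Adding one block convolves the counts by size, which is how coefficients of a product
  arise. The polynomials are fixed only through their coefficients, so that \<open>line_poly\<close>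
  and a monomial can be mixed in one product.\<close>

lemma card_restricted_subsets:
  fixes p :: "'i \<Rightarrow> nat poly"
  assumes "finite I"
    and "\<And>i. i \<in> I \<Longrightarrow> finite (A i)"
    and "disjoint_family_on A I"
    and "\<And>i k. i \<in> I \<Longrightarrow> coeff (p i) k = (if k \<in> K i then card (A i) choose k else 0)"
  shows "card (restricted_subsets I A K m) = coeff (\<Prod>i\<in>I. p i) m"
  using assms
proof (induction I arbitrary: m rule: finite_induct)
  case empty
  have "restricted_subsets {} A K m = (if m = 0 then {{}} else {})"
    by (auto simp: restricted_subsets_def)
  then show ?case by (simp add: coeff_1)
next
  case (insert i I)
  let ?D = "\<lambda>k. {T. T \<subseteq> A i \<and> card T = k}"
  have finA: "finite (A i)" and finD: "finite (?D k)" for k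
    using insert.prems by auto
  have IH: "card (restricted_subsets I A K m) = coeff (\<Prod>i\<in>I. p i) m" for m
    using insert.prems by (intro insert.IH) (auto simp: disjoint_family_on_def)
  \<comment> \<open>Grouping the traces by size makes the summand constant on each group, so every
    size \<open>k\<close> contributes a binomial coefficient.\<close>
  have eq: "{T. T \<subseteq> A i \<and> card T \<in> K i \<and> card T \<le> m} = (\<Union>k\<in>{..m} \<inter> K i. ?D k)"
    by auto
  have "card (restricted_subsets (insert i I) A K m) =
      card (SIGMA T : (\<Union>k\<in>{..m} \<inter> K i. ?D k). restricted_subsets I A K (m - card T))"
    unfolding eq[symmetric]
    by (rule bij_betw_same_card[symmetric],
        rule bij_betw_restricted_subsets_insert[OF insert.hyps insert.prems(1,2)])
  also have "\<dots> = (\<Sum>T\<in>(\<Union>k\<in>{..m} \<inter> K i. ?D k). card (restricted_subsets I A K (m - card T)))"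
    using finD insert.hyps(1) insert.prems(1) by (auto intro!: card_SigmaI finite_restricted_subsets)
  also have "\<dots> = (\<Sum>k\<in>{..m} \<inter> K i. \<Sum>T\<in>?D k. card (restricted_subsets I A K (m - card T)))"
    by (rule sum.UNION_disjoint) (auto simp: finA)
  also have "\<dots> = (\<Sum>k\<in>{..m} \<inter> K i. (card (A i) choose k) * coeff (\<Prod>i\<in>I. p i) (m - k))"
    by (intro sum.cong) (simp_all add: IH n_subsets[OF finA])
  \<comment> \<open>Sizes outside \<open>K i\<close> have coefficient 0, so the sum extends to all
    \<open>k \<le> m\<close> and becomes a Cauchy product.\<close>
  also have "\<dots> = (\<Sum>k\<le>m. coeff (p i) k * coeff (\<Prod>i\<in>I. p i) (m - k))"
    unfolding sum.inter_restrict[OF finite_atMost]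
    by (intro sum.cong) (simp_all add: insert.prems(3))
  finally show ?case
    using insert.hyps by (simp add: coeff_mult)
qed

text \<open>Choosing \<open>min (card (A i)) d\<close> points in every block gives a set as large as
  the bound; its subsets of size \<open>m\<close> still obey the upper limits, as these pass to
  subsets.\<close>

lemma restricted_subsets_atMost_nonempty:
  assumes "finite I"
    and fin: "\<And>i. i \<in> I \<Longrightarrow> finite (A i)"
    and disj: "disjoint_family_on A I"
    and "m \<le> (\<Sum>i\<in>I. min (card (A i)) d)"
  shows "restricted_subsets I A (\<lambda>_. {..d}) m \<noteq> {}"
proof -
  have "\<exists>T. T \<subseteq> A i \<and> card T = min (card (A i)) d" for i
    by (meson min.cobounded1 obtain_subset_with_card_n)
  then obtain T where T: "\<And>i. T i \<subseteq> A i" "\<And>i. card (T i) = min (card (A i)) d"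
    by metis
  have finT: "finite (T i)" if "i \<in> I" for i
    using T(1) fin[OF that] finite_subset by blast
  have "card (\<Union>i\<in>I. T i) = (\<Sum>i\<in>I. card (T i))"
    using T(1) disj finT assms(1)
    by (intro card_UN_disjoint) (auto simp: disjoint_family_on_def, blast)
  then obtain S where S: "S \<subseteq> (\<Union>i\<in>I. T i)" "card S = m"
    using assms(4) T(2) by (metis (no_types, lifting) obtain_subset_with_card_n sum.cong)
  have "card (S \<inter> A i) \<le> d" if "i \<in> I" for i
  proof -
    \<comment> \<open>Points chosen in other blocks do not lie in \<open>A i\<close>, so the trace
      of \<open>S\<close> on \<open>A i\<close> is contained in \<open>T i\<close>.\<close>
    have "T j \<inter> A i = {}" if "j \<in> I" "j \<noteq> i" for j
      using disj T(1) \<open>i \<in> I\<close> that by (fastforce simp: disjoint_family_on_def)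
    then have "S \<inter> A i \<subseteq> T i"
      using S by blast
    then have "card (S \<inter> A i) \<le> card (T i)"
      using finT[OF that] by (rule card_mono[rotated])
    then show ?thesis using T(2)[of i] by simp
  qed
  moreover have "S \<subseteq> (\<Union>i\<in>I. A i)"
    using S T(1) by blast
  ultimately have "S \<in> restricted_subsets I A (\<lambda>_. {..d}) m"
    using S by (simp add: restricted_subsets_def)
  then show ?thesis by blast
qed

lemma equiv_same_line: "equiv (grid n) (same_line n v)"
proof (rule equivI)
  show "same_line n v \<subseteq> grid n \<times> grid n"
    by (auto simp: same_line_def)
  show "refl_on (grid n) (same_line n v)"
    by (auto simp: refl_on_def same_line_def zero_prod_def intro!: exI[of _ 0])
  show "sym (same_line n v)"
  proof (rule symI)
    fix p q assume "(p, q) \<in> same_line n v"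
    then obtain k where "p \<in> grid n" "q \<in> grid n" "q - p = (k * fst v, k * snd v)"
      by (auto simp: same_line_def)
    then show "(q, p) \<in> same_line n v"
      by (auto simp: same_line_def prod_eq_iff intro!: exI[of _ "- k"])
  qed
  show "trans (same_line n v)"
  proof (rule transI)
    fix p q s assume "(p, q) \<in> same_line n v" "(q, s) \<in> same_line n v"
    then obtain j k where "p \<in> grid n" "s \<in> grid n"
      "q - p = (j * fst v, j * snd v)" "s - q = (k * fst v, k * snd v)"
      by (auto simp: same_line_def)
    then show "(p, s) \<in> same_line n v"
      by (auto simp: same_line_def prod_eq_iff algebra_simps intro!: exI[of _ "j + k"])
  qed
qed

text \<open>This is the coefficient condition of \<open>card_restricted_subsets\<close> for
  \<open>K i = {..2}\<close>. The case split is essential: \<open>L choose k\<close> can be positive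
  for \<open>k > 2\<close>.\<close>

lemma coeff_line_poly: "coeff (line_poly L) k = (if k \<in> {..2} then L choose k else 0)"
proof -
  consider "k = 0" | "k = 1" | "k = 2" | "k > 2"
    by linarith
  then show ?thesis
    by cases (auto simp: line_poly_def coeff_pCons numeral_2_eq_2 split: nat.splits)
qed

theorem theorem6p1:
  fixes n r m :: nat and a b :: int and l :: "nat \<Rightarrow> (int \<times> int) set" and L :: "nat \<Rightarrow> nat"
  assumes "n \<ge> 1"
    and "gcd a b = 1"
    and "bij_betw l {1..r} (lines n (a, b))"
    and "\<And>i. i \<in> {1..r} \<Longrightarrow> L i = card (l i)"
    and "2 \<le> m" and "m \<le> (\<Sum>i = 1..r. min (L i) 2)"
  shows "card (admissible n (a, b) m) = coeff (\<Prod>i = 1..r. line_poly (L i)) m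
    \<and> measure_pmf.expectation (pmf_of_set (admissible n (a, b) m))
           (\<lambda>S. real (card {i \<in> {1..r}. card (S \<inter> l i) = 2}))
         = 1 / real (coeff (\<Prod>i = 1..r. line_poly (L i)) m)
           * real (\<Sum>i = 1..r. (L i choose 2) * coeff (\<Prod>j \<in> {1..r} - {i}. line_poly (L j)) (m - 2))"
proof -
  let ?I = "{1..r}"
  let ?adm = "admissible n (a, b) m"
  have ran: "l ` ?I = lines n (a, b)" and inj: "inj_on l ?I"
    using assms(3) by (auto simp: bij_betw_def)
  have Un: "(\<Union>i\<in>?I. l i) = grid n"
    using Union_quotient[OF equiv_same_line] ran by (simp add: lines_def)
  have disj: "disjoint_family_on l ?I"
    unfolding disjoint_family_on_def
  proof (intro ballI impI)
    fix i j assume ij: "i \<in> ?I" "j \<in> ?I" "i \<noteq> j"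
    have "l i \<in> lines n (a, b)" "l j \<in> lines n (a, b)"
      using ran ij by blast+
    moreover have "l i \<noteq> l j"
      using inj_onD[OF inj] ij by blast
    ultimately show "l i \<inter> l j = {}"
      using quotient_disj[OF equiv_same_line, of "l i" n "(a, b)" "l j"] unfolding lines_def by blast
  qed
  have fin: "finite (l i)" if "i \<in> ?I" for i
  proof (rule finite_subset)
    show "l i \<subseteq> grid n" using that Un by blast
  qed (simp add: grid_def)
  have coeff_L: "coeff (line_poly (L i)) k = (if k \<in> {..2} then card (l i) choose k else 0)"
    if "i \<in> ?I" for i k
    using assms(4)[OF that] by (simp add: coeff_line_poly)
  have adm: "?adm = restricted_subsets ?I l (\<lambda>_. {..2}) m"
    unfolding admissible_def restricted_subsets_def Un ran[symmetric] by simp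
  have card_adm: "card ?adm = coeff (\<Prod>i\<in>?I. line_poly (L i)) m"
    unfolding adm by (rule card_restricted_subsets[OF _ fin disj coeff_L]) simp_all
  have fin_adm: "finite ?adm"
    unfolding adm by (rule finite_restricted_subsets[OF _ fin]) simp_all
  \<comment> \<open>The upper bound on \<open>m\<close> enters here: the uniform distribution needs
    a nonempty support.\<close>
  have "m \<le> (\<Sum>i\<in>?I. min (card (l i)) 2)"
    using assms(4,6) by simp
  then have ne: "?adm \<noteq> {}"
    unfolding adm by (rule restricted_subsets_atMost_nonempty[OF _ fin disj, rotated 2]) simp_all
  have two: "card {S \<in> ?adm. card (S \<inter> l i) = 2} =
      (L i choose 2) * coeff (\<Prod>j\<in>?I - {i}. line_poly (L j)) (m - 2)" if i: "i \<in> ?I" for i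
  proof -
    let ?K = "(\<lambda>_. {..2})(i := {2::nat})"
    \<comment> \<open>A line forced to contain exactly two cells keeps only the quadratic term of
      its polynomial.\<close>
    let ?p = "(\<lambda>j. line_poly (L j))(i := monom (L i choose 2) 2)"
    have "{S \<in> ?adm. card (S \<inter> l i) = 2} = restricted_subsets ?I l ?K m"
      using i unfolding adm by (auto simp: restricted_subsets_def split: if_splits)
    also have "card \<dots> = coeff (\<Prod>j\<in>?I. ?p j) m"
    proof (rule card_restricted_subsets[OF _ fin disj])
      show "coeff (?p j) k = (if k \<in> ?K j then card (l j) choose k else 0)" if "j \<in> ?I" for j k
        using coeff_L[OF that, of k] assms(4)[OF that] by (cases "j = i") simp_all
    qed simp_all
    also have "(\<Prod>j\<in>?I. ?p j) = monom (L i choose 2) 2 * (\<Prod>j\<in>?I - {i}. line_poly (L j))"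
      using i by (subst prod.remove[of _ i]) auto
    \<comment> \<open>The factor of degree 2 shifts the index; \<open>2 \<le> m\<close> makes
      \<open>m - 2\<close> a genuine difference.\<close>
    also have "coeff \<dots> m = (L i choose 2) * coeff (\<Prod>j\<in>?I - {i}. line_poly (L j)) (m - 2)"
      using assms(5) by (simp add: coeff_monom_mult)
    finally show ?thesis .
  qed
  \<comment> \<open>Double counting of the pairs of an admissible \<open>S\<close> and an index
    \<open>i\<close> whose line meets \<open>S\<close> twice.\<close>
  have "(\<Sum>S\<in>?adm. card {i \<in> ?I. card (S \<inter> l i) = 2}) = (\<Sum>i\<in>?I. card {S \<in> ?adm. card (S \<inter> l i) = 2})"
    using sum.swap_restrict[OF fin_adm, of ?I "\<lambda>_ _. 1 :: nat" "\<lambda>S i. card (S \<inter> l i) = 2"] by simp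
  also have "\<dots> = (\<Sum>i\<in>?I. (L i choose 2) * coeff (\<Prod>j\<in>?I - {i}. line_poly (L j)) (m - 2))"
    by (intro sum.cong refl two)
  finally have "(\<Sum>S\<in>?adm. real (card {i \<in> ?I. card (S \<inter> l i) = 2})) =
      real (\<Sum>i\<in>?I. (L i choose 2) * coeff (\<Prod>j\<in>?I - {i}. line_poly (L j)) (m - 2))"
    by (simp only: flip: of_nat_sum)
  \<comment> \<open>The uniform expectation is the sum over \<open>?adm\<close> divided by its
    cardinality, which \<open>card_adm\<close> turns into the coefficient.\<close>
  then show ?thesis
    unfolding integral_pmf_of_set[OF ne fin_adm] card_adm by (simp only: times_divide_eq_left mult_1)
qed

end
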